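(* Let $K\ge 2$. The algorithm Modified Next Fit with parameter $K$ for the server renting problem has (asymptotic) competitive ratio at most $$K\cdot \max\left\{1,\frac{\mu}{K-1}\right\}+1.$$
   Context: Server renting problem: items (jobs) arrive online. Each item has a size in $(0,1]$, an arrival time and a departure time; its length is departure time minus arrival time, and all lengths lie in $[\Delta,\mu\Delta]$ for fixed $\Delta>0$ and $\mu\ge 1$. On arrival of an item, the online algorithm learns its size but not its departure time, and must irrevocably assign it to a bin (server) of capacity $1$, either an already opened, not yet released bin or a newly opened bin, so that at every time the total size of the items currently present in each bin is at most $1$. A bin is released when all items assigned to it have departed. If an algorithm opens bins $B_1,\dots,B_m$, its cost is $\sum_i t_i$, where $t_i$ is the length of the interval between opening and release of $B_i$. $\mathrm{OPT}(\sigma)$ denotes the optimal offline cost. An online algorithm $A$ has (asymptotic) competitive ratio at most $c$ if there is a constant $b$ independent of $\sigma$ with $A(\sigma)\le c\cdot\mathrm{OPT}(\sigma)+b$ for all input sequences $\sigma$. Next Fit strategy: at any time there is at most one "current" bin; an arriving item is placed in the current bin if it fits; otherwise the current bin is closed (never receives items again but stays rented until released) and a new bin is opened for the item and becomes current (also a new bin is opened if there is no current bin). Modified Next Fit with parameter $K$: items of size smaller than $1/K$ are packed using the Next Fit strategy in one family of bins, and items of size at least $1/K$ are packed separately, also using the Next Fit strategy, in a disjoint family of bins (small and large items never share a bin). *)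

theory Defs
  imports Complex_Main "HOL-Library.Multiset"
begin

datatype item = Item (isize: real) (arrival: real) (departure: real)

text \<open>
  An item occupies its bin during the half-open interval from arrival (included) to
  departure (excluded): an item departing at time \<open>t\<close> makes room for one arriving at \<open>t\<close>.
\<close>

definition present :: "real \<Rightarrow> item \<Rightarrow> bool" where
  "present t x \<longleftrightarrow> arrival x \<le> t \<and> t < departure x"

text \<open>
  An input is listed in the order in which the items are revealed; simultaneous arrivals are
  revealed one after the other.
\<close>

definition server_input :: "real \<Rightarrow> real \<Rightarrow> item list \<Rightarrow> bool" where
  "server_input \<Delta> \<mu> \<sigma> \<longleftrightarrow>
     sorted (map arrival \<sigma>) \<and>
     (\<forall>x\<in>set \<sigma>. 0 < isize x \<and> isize x \<le> 1 \<and>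
        \<Delta> \<le> departure x - arrival x \<and> departure x - arrival x \<le> \<mu> * \<Delta>)"

text \<open>
  A bin is the list of all items ever assigned to it; the order in this list is irrelevant
  for the notions below.
\<close>

type_synonym bin = "item list"

definition load :: "real \<Rightarrow> bin \<Rightarrow> real" where
  "load t B = sum_list (map isize (filter (present t) B))"

definition open_time :: "bin \<Rightarrow> real" where
  "open_time B = Min (arrival ` set B)"

definition release_time :: "bin \<Rightarrow> real" where
  "release_time B = Max (departure ` set B)"

text \<open>
  The last conjunct says that no item is assigned to a bin that has already been released,
  i.e. that a bin never becomes empty between its opening and the last departure from it.
\<close>

definition feasible_bin :: "bin \<Rightarrow> bool" where
  "feasible_bin B \<longleftrightarrow>
     B \<noteq> [] \<and> (\<forall>t. load t B \<le> 1) \<and>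
     (\<forall>t. open_time B \<le> t \<and> t < release_time B \<longrightarrow> (\<exists>x\<in>set B. present t x))"

text \<open>
  Items agreeing in size, arrival and departure are interchangeable, so it is enough to
  account for items up to multiplicity.
\<close>

definition packing :: "item list \<Rightarrow> bin list \<Rightarrow> bool" where
  "packing \<sigma> Bs \<longleftrightarrow> mset (concat Bs) = mset \<sigma> \<and> (\<forall>B\<in>set Bs. feasible_bin B)"

definition cost :: "bin list \<Rightarrow> real" where
  "cost Bs = (\<Sum>B\<leftarrow>Bs. release_time B - open_time B)"

definition OPT :: "item list \<Rightarrow> real" where
  "OPT \<sigma> = Inf {cost Bs | Bs. packing \<sigma> Bs}"

definition competitive_ratio_at_most ::
    "real \<Rightarrow> real \<Rightarrow> (item list \<Rightarrow> bin list) \<Rightarrow> real \<Rightarrow> bool" where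
  "competitive_ratio_at_most \<Delta> \<mu> A c \<longleftrightarrow>
     (\<exists>b. \<forall>\<sigma>. server_input \<Delta> \<mu> \<sigma> \<longrightarrow> cost (A \<sigma>) \<le> c * OPT \<sigma> + b)"

text \<open>
  The most recently opened bin is at the head of the list. It is the current bin, unless it
  has been released by the time the new item arrives; all other bins are closed. Departure
  times enter only through the question which items are still present at the arrival of the
  new item.
\<close>

fun next_fit_step :: "item \<Rightarrow> bin list \<Rightarrow> bin list" where
  "next_fit_step x [] = [[x]]"
| "next_fit_step x (B # Bs) =
     (if (\<exists>y\<in>set B. present (arrival x) y) \<and> load (arrival x) B + isize x \<le> 1
      then (x # B) # Bs
      else [x] # B # Bs)"

definition next_fit :: "item list \<Rightarrow> bin list" where
  "next_fit \<sigma> = fold next_fit_step \<sigma> []"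

definition modified_next_fit :: "real \<Rightarrow> item list \<Rightarrow> bin list" where
  "modified_next_fit K \<sigma> =
     next_fit (filter (\<lambda>x. isize x < 1 / K) \<sigma>) @
     next_fit (filter (\<lambda>x. 1 / K \<le> isize x) \<sigma>)"

lemma load_mono:
  assumes "\<forall>y\<in>set B. 0 < isize y" "\<forall>y\<in>set B. arrival y \<le> s" "s \<le> t"
  shows "load t B \<le> load s B"
  using assms unfolding load_def by (induction B) (auto simp: present_def)

lemma feasible_singleton:
  assumes "isize x \<le> 1"
  shows "feasible_bin [x]"
  using assms by (auto simp: feasible_bin_def load_def open_time_def release_time_def present_def)

lemma feasible_Cons:
  assumes B: "feasible_bin B"
    and pos: "\<forall>y\<in>set B. 0 < isize y"
    and arr: "\<forall>y\<in>set B. arrival y \<le> arrival x"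
    and pres: "\<exists>y\<in>set B. present (arrival x) y"
    and fits: "load (arrival x) B + isize x \<le> 1"
  shows "feasible_bin (x # B)"
proof -
  have ne: "set B \<noteq> {}" using B by (auto simp: feasible_bin_def)
  obtain y where y: "y \<in> set B" "present (arrival x) y" using pres by blast
  have "open_time B \<le> arrival y" "departure y \<le> release_time B"
    using y by (auto simp: open_time_def release_time_def)
  then have ox: "open_time B \<le> arrival x" and rx: "arrival x < release_time B"
    using y by (auto simp: present_def)
  have o: "open_time (x # B) = open_time B"
    using ox ne by (simp add: open_time_def)
  have r: "release_time (x # B) = max (departure x) (release_time B)"
    using ne by (simp add: release_time_def)
  have "load t (x # B) \<le> 1" for t
  proof (cases "present t x")
    case True
    then have "load t B \<le> load (arrival x) B"
      using load_mono[OF pos arr] by (auto simp: present_def)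
    then show ?thesis using True fits by (simp add: load_def)
  next
    case False
    then show ?thesis using B by (simp add: load_def feasible_bin_def)
  qed
  moreover have "\<exists>z\<in>set (x # B). present t z"
    if "open_time (x # B) \<le> t" "t < release_time (x # B)" for t
  proof (cases "t < release_time B")
    case True
    then show ?thesis using that B o by (auto simp: feasible_bin_def)
  next
    case False
    then show ?thesis using that r rx by (auto simp: present_def)
  qed
  ultimately show ?thesis by (simp add: feasible_bin_def)
qed

lemma packing_next_fit:
  assumes "sorted (map arrival \<sigma>)" "\<forall>x\<in>set \<sigma>. 0 < isize x \<and> isize x \<le> 1"
  shows "packing \<sigma> (next_fit \<sigma>)"
  using assms
proof (induction \<sigma> rule: rev_induct)
  case Nil
  then show ?case by (simp add: next_fit_def packing_def)
next
  case (snoc x \<sigma>)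
  have IH: "packing \<sigma> (next_fit \<sigma>)"
    using snoc by (simp add: sorted_append)
  have step: "next_fit (\<sigma> @ [x]) = next_fit_step x (next_fit \<sigma>)"
    by (simp add: next_fit_def)
  have x: "feasible_bin [x]" using snoc.prems by (simp add: feasible_singleton)
  show ?case
  proof (cases "next_fit \<sigma>")
    case Nil
    then show ?thesis using IH x unfolding step by (simp add: packing_def)
  next
    case (Cons B Bs)
    have "set (concat (next_fit \<sigma>)) = set \<sigma>"
      using IH unfolding packing_def by (metis set_mset_mset)
    then have "set B \<subseteq> set \<sigma>" using Cons by auto
    then have "\<forall>y\<in>set B. 0 < isize y" "\<forall>y\<in>set B. arrival y \<le> arrival x"
      using snoc.prems by (auto simp: sorted_append)
    then show ?thesis
      using IH x Cons feasible_Cons[of B x] unfolding step by (auto simp: packing_def)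
  qed
qed

text \<open>Modified Next Fit produces feasible packings, so its cost is that of a solution.\<close>

lemma packing_modified_next_fit:
  assumes "server_input \<Delta> \<mu> \<sigma>"
  shows "packing \<sigma> (modified_next_fit K \<sigma>)"
proof -
  let ?s = "filter (\<lambda>x. isize x < 1 / K) \<sigma>" and ?l = "filter (\<lambda>x. 1 / K \<le> isize x) \<sigma>"
  have "packing ?s (next_fit ?s)" "packing ?l (next_fit ?l)"
    using assms by (auto simp: server_input_def sorted_filter intro!: packing_next_fit)
  moreover have "mset ?s + mset ?l = mset \<sigma>"
    by (induction \<sigma>) auto
  ultimately show ?thesis
    by (auto simp: packing_def modified_next_fit_def)
qed

end

theory Submission
  imports Defs "HOL-Analysis.Lebesgue_Measure" "HOL-Analysis.Bochner_Integration"
begin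

text \<open>
  The optimal cost is bounded below by the total area (size times length) of the items and by
  the measure of the set of times at which some item is present. A bin with large items costs
  at most the sum of their lengths, hence at most \<open>K\<close> times their area. For small items, the
  periods during which the successive bins are current are disjoint and busy; what a bin costs
  after it was closed is at most \<open>\<mu> * \<Delta>\<close>, while its load at closing time exceeds
  \<open>1 - 1 / K\<close>, so that its items have area at least \<open>(1 - 1 / K) * \<Delta>\<close>.
\<close>

section \<open>Area and busy time of a list of items\<close>

definition area :: "item list \<Rightarrow> real" where
  "area B = (\<Sum>x\<leftarrow>B. isize x * (departure x - arrival x))"

text \<open>Half-open intervals match \<open>present\<close>, so membership means that some item is
  present. As a set it counts overlapping items only once when measured.\<close>

definition busy :: "item list \<Rightarrow> real set" where
  "busy B = (\<Union>x\<in>set B. {arrival x..<departure x})"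

lemma mem_busy_iff: "t \<in> busy B \<longleftrightarrow> (\<exists>x\<in>set B. present t x)"
  by (auto simp: busy_def present_def)

lemma busy_mono: "set B \<subseteq> set C \<Longrightarrow> busy B \<subseteq> busy C"
  by (auto simp: busy_def)

lemma fmeasurable_Ico: "{a..<b :: real} \<in> fmeasurable lborel"
  by (cases "a \<le> b") (auto intro: fmeasurableI)

lemma fmeasurable_busy: "busy B \<in> fmeasurable lborel"
  unfolding busy_def by (intro fmeasurable.finite_UN finite_set fmeasurable_Ico)

lemma fmeasurable_busy_before: "busy B \<inter> {..<t} \<in> fmeasurable lborel"
  by (intro fmeasurable_Int_fmeasurable fmeasurable_busy) auto

text \<open>As simp rules these discharge the side conditions of subadditivity and monotonicity of
  the measure. The truncated sets \<open>busy B \<inter> {..<t}\<close> occur in the analysis of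
  Next Fit.\<close>

lemmas busy_measurable [simp] =
  fmeasurable_busy fmeasurableD[OF fmeasurable_busy, simplified]
  fmeasurable_busy_before fmeasurableD[OF fmeasurable_busy_before, simplified]

lemma area_append: "area (B @ C) = area B + area C"
  by (simp add: area_def)

lemma area_concat: "area (concat Bs) = (\<Sum>B\<leftarrow>Bs. area B)"
  by (induction Bs) (auto simp: area_def)

lemma area_mset: "mset B = mset C \<Longrightarrow> area B = area C"
  unfolding area_def by (metis mset_map sum_mset_sum_list)

lemma area_nonneg:
  assumes "\<forall>x\<in>set B. 0 \<le> isize x \<and> arrival x \<le> departure x"
  shows "0 \<le> area B"
  using assms unfolding area_def by (auto intro!: sum_list_nonneg)

lemma area_filter: "area (filter P B) + area (filter (\<lambda>x. \<not> P x) B) = area B"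
  by (induction B) (auto simp: area_def)

section \<open>Cost of a single bin\<close>

lemma open_time_le: "x \<in> set B \<Longrightarrow> open_time B \<le> arrival x"
  by (simp add: open_time_def)

lemma release_time_ge: "x \<in> set B \<Longrightarrow> departure x \<le> release_time B"
  by (simp add: release_time_def)

text \<open>A feasible bin has no gap between opening and release, so its rental period is exactly
  the union of the lifetimes of its items. This turns the cost of a bin into a measure.\<close>

lemma busy_feasible_bin:
  assumes "feasible_bin B"
  shows "busy B = {open_time B..<release_time B}"
proof
  show "busy B \<subseteq> {open_time B..<release_time B}"
    using open_time_le[of _ B] release_time_ge[of _ B] by (force simp: busy_def)
  show "{open_time B..<release_time B} \<subseteq> busy B"
    using assms by (auto simp: mem_busy_iff feasible_bin_def)
qed

lemma open_time_le_release_time: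
  assumes "feasible_bin B" "\<forall>x\<in>set B. arrival x \<le> departure x"
  shows "open_time B \<le> release_time B"
proof -
  obtain x where "x \<in> set B"
    using assms(1) by (cases B) (auto simp: feasible_bin_def)
  then show ?thesis
    using open_time_le[of x B] release_time_ge[of x B] assms(2) by force
qed

lemma measure_busy_feasible_bin:
  assumes "feasible_bin B" "\<forall>x\<in>set B. arrival x \<le> departure x"
  shows "measure lborel (busy B) = release_time B - open_time B"
  using open_time_le_release_time[OF assms] by (simp add: busy_feasible_bin[OF assms(1)])

lemma measure_busy_le:
  assumes "\<forall>x\<in>set B. arrival x \<le> departure x"
  shows "measure lborel (busy B) \<le> (\<Sum>x\<leftarrow>B. departure x - arrival x)"
  using assms
proof (induction B)
  case Nil
  then show ?case by (simp add: busy_def)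
next
  case (Cons x B)
  have "busy (x # B) = {arrival x..<departure x} \<union> busy B"
    by (simp add: busy_def)
  then have "measure lborel (busy (x # B)) \<le> measure lborel {arrival x..<departure x} + measure lborel (busy B)"
    by (simp add: measure_Un_le)
  then show ?case using Cons by simp
qed

text \<open>The load is a finite sum of step functions, one per item, with value
  \<open>isize x\<close> on the lifetime of \<open>x\<close>; linearity of the integral gives the
  area.\<close>

lemma has_bochner_integral_load:
  assumes "\<forall>x\<in>set B. arrival x \<le> departure x"
  shows "has_bochner_integral lborel (\<lambda>t. load t B) (area B)"
  using assms
proof (induction B)
  case Nil
  then show ?case by (simp add: load_def area_def has_bochner_integral_zero)
next
  case (Cons x B)
  have "has_bochner_integral lborel (indicator {arrival x..<departure x})
      (measure lborel {arrival x..<departure x})"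
    using fmeasurable_Ico by (intro has_bochner_integral_real_indicator) (auto simp: fmeasurable_def)
  then have "has_bochner_integral lborel (\<lambda>t. isize x * indicator {arrival x..<departure x} t)
      (isize x * (departure x - arrival x))"
    using Cons.prems by (intro has_bochner_integral_mult_right) auto
  moreover have "has_bochner_integral lborel (\<lambda>t. load t B) (area B)"
    using Cons by auto
  ultimately have "has_bochner_integral lborel
      (\<lambda>t. isize x * indicator {arrival x..<departure x} t + load t B)
      (isize x * (departure x - arrival x) + area B)"
    by (rule has_bochner_integral_add)
  moreover have "(\<lambda>t. isize x * indicator {arrival x..<departure x} t + load t B) = (\<lambda>t. load t (x # B))"
    by (auto simp: load_def present_def fun_eq_iff indicator_def)
  ultimately show ?case by (simp add: area_def)
qed

text \<open>By the capacity constraint the load is at most the indicator of the busy set.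
  Integrating both sides compares area with rental time.\<close>

lemma area_le_feasible_bin:
  assumes B: "feasible_bin B" and len: "\<forall>x\<in>set B. arrival x \<le> departure x"
  shows "area B \<le> release_time B - open_time B"
proof -
  have "has_bochner_integral lborel (indicator (busy B)) (measure lborel (busy B))"
    using fmeasurable_busy[of B]
    by (intro has_bochner_integral_real_indicator) (auto simp: fmeasurable_def)
  moreover have "load t B \<le> indicator (busy B) t" for t
  proof (cases "t \<in> busy B")
    case True
    then show ?thesis using B by (simp add: feasible_bin_def)
  next
    case False
    then have "filter (present t) B = []"
      by (auto simp: mem_busy_iff filter_empty_conv)
    then show ?thesis by (simp add: load_def)
  qed
  ultimately have "area B \<le> measure lborel (busy B)"
    using has_bochner_integral_load[OF len]
      integral_mono[of lborel "\<lambda>t. load t B" "indicator (busy B)"]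
    by (simp add: has_bochner_integral_iff)
  then show ?thesis by (simp add: measure_busy_feasible_bin[OF B len])
qed

section \<open>Lower bounds on the cost of any packing\<close>

lemma set_packing:
  assumes "packing \<sigma> Bs"
  shows "(\<Union>B\<in>set Bs. set B) = set \<sigma>"
proof -
  have "set (concat Bs) = set \<sigma>"
    using assms unfolding packing_def by (metis set_mset_mset)
  then show ?thesis by simp
qed

lemma area_le_cost:
  assumes "packing \<sigma> Bs" "\<forall>x\<in>set \<sigma>. arrival x \<le> departure x"
  shows "area \<sigma> \<le> cost Bs"
proof -
  have "area \<sigma> = area (concat Bs)"
    using assms(1) by (auto simp: packing_def intro: area_mset)
  also have "\<dots> = (\<Sum>B\<leftarrow>Bs. area B)" by (rule area_concat)
  also have "\<dots> \<le> cost Bs"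
    unfolding cost_def using assms set_packing[OF assms(1)]
    by (intro sum_list_mono area_le_feasible_bin) (auto simp: packing_def)
  finally show ?thesis .
qed

lemma measure_busy_concat_le:
  "measure lborel (busy (concat Bs)) \<le> (\<Sum>B\<leftarrow>Bs. measure lborel (busy B))"
proof (induction Bs)
  case Nil
  then show ?case by (simp add: busy_def)
next
  case (Cons B Bs)
  have "busy (concat (B # Bs)) = busy B \<union> busy (concat Bs)"
    by (auto simp: busy_def)
  then have "measure lborel (busy (concat (B # Bs))) \<le> measure lborel (busy B) + measure lborel (busy (concat Bs))"
    by (simp add: measure_Un_le)
  then show ?case using Cons by simp
qed

text \<open>Whenever an item is present, its bin is rented: the rental periods cover the busy set,
  and the measure is subadditive over the bins.\<close>

lemma measure_busy_le_cost:
  assumes "packing \<sigma> Bs" "\<forall>x\<in>set \<sigma>. arrival x \<le> departure x"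
  shows "measure lborel (busy \<sigma>) \<le> cost Bs"
proof -
  have "busy \<sigma> = busy (concat Bs)"
    using set_packing[OF assms(1)] by (auto simp: busy_def)
  then have "measure lborel (busy \<sigma>) \<le> (\<Sum>B\<leftarrow>Bs. measure lborel (busy B))"
    by (simp add: measure_busy_concat_le)
  also have "\<dots> \<le> cost Bs"
    unfolding cost_def using assms set_packing[OF assms(1)]
    by (intro sum_list_mono eq_refl measure_busy_feasible_bin) (auto simp: packing_def)
  finally show ?thesis .
qed

section \<open>Bins with large items\<close>

text \<open>A bin is rented for at most the sum of its item lengths, and
  \<open>1 \<le> K * isize x\<close> bounds each length by \<open>K\<close> times the area of the
  item. The argument applies to every packing of large items.\<close>

lemma cost_le_area:
  assumes "packing \<sigma> Bs" "K > 0"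
    and "\<forall>x\<in>set \<sigma>. arrival x \<le> departure x \<and> 1 / K \<le> isize x"
  shows "cost Bs \<le> K * area \<sigma>"
proof -
  have "release_time B - open_time B \<le> K * area B" if B: "B \<in> set Bs" for B
  proof -
    have x: "arrival x \<le> departure x \<and> 1 / K \<le> isize x" if "x \<in> set B" for x
      using set_packing[OF assms(1)] B that assms(3) by blast
    have "release_time B - open_time B = measure lborel (busy B)"
      using assms(1) B x by (simp add: packing_def measure_busy_feasible_bin)
    also have "\<dots> \<le> (\<Sum>x\<leftarrow>B. departure x - arrival x)"
      using x by (simp add: measure_busy_le)
    also have "\<dots> \<le> (\<Sum>x\<leftarrow>B. K * (isize x * (departure x - arrival x)))"
    proof (rule sum_list_mono)
      fix x assume "x \<in> set B"
      then have "1 * (departure x - arrival x) \<le> (K * isize x) * (departure x - arrival x)"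
        using x[of x] \<open>K > 0\<close> by (intro mult_right_mono) (auto simp: field_simps)
      then show "departure x - arrival x \<le> K * (isize x * (departure x - arrival x))"
        by (simp add: mult.assoc)
    qed
    also have "\<dots> = K * area B" by (simp add: area_def sum_list_const_mult)
    finally show ?thesis .
  qed
  then have "cost Bs \<le> (\<Sum>B\<leftarrow>Bs. K * area B)"
    unfolding cost_def by (intro sum_list_mono)
  also have "\<dots> = K * area (concat Bs)" by (simp add: area_concat sum_list_const_mult)
  also have "area (concat Bs) = area \<sigma>"
    using assms(1) by (auto simp: packing_def intro: area_mset)
  finally show ?thesis .
qed

section \<open>Next Fit on small items\<close>

text \<open>Every item counted in the load at time \<open>t\<close> contributes its size over a
  whole lifetime of at least \<Delta>; the remaining items contribute nonnegative area.\<close>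

lemma load_le_area:
  assumes "\<forall>x\<in>set B. 0 \<le> isize x \<and> \<Delta> \<le> departure x - arrival x" "0 \<le> \<Delta>"
  shows "load t B * \<Delta> \<le> area B"
  using assms
proof (induction B)
  case Nil
  then show ?case by (simp add: load_def area_def)
next
  case (Cons x B)
  have "isize x * \<Delta> \<le> isize x * (departure x - arrival x)"
    using Cons.prems by (intro mult_left_mono) auto
  moreover have "0 \<le> isize x * \<Delta>" using Cons.prems by simp
  moreover have "load t B * \<Delta> \<le> area B" using Cons by simp
  ultimately show ?case by (auto simp: load_def area_def algebra_simps)
qed

lemma next_fit_snoc: "next_fit (\<sigma> @ [x]) = next_fit_step x (next_fit \<sigma>)"
  by (simp add: next_fit_def)

lemma next_fit_eq_Nil_iff: "next_fit \<sigma> = [] \<longleftrightarrow> \<sigma> = []"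
proof (cases \<sigma> rule: rev_cases)
  case Nil
  then show ?thesis by (simp add: next_fit_def)
next
  case (snoc \<tau> x)
  then show ?thesis by (cases "next_fit \<tau>") (auto simp: next_fit_snoc)
qed

text \<open>Up to its release a feasible bin is never empty, so \<open>{open_time B..<s}\<close>
  consists of busy times, disjoint from those before the opening. It is used with \<open>s\<close>
  the release time or the arrival that closes the bin.\<close>

lemma measure_busy_before_add:
  assumes "set B \<subseteq> set \<sigma>" "feasible_bin B" "s \<le> release_time B" "open_time B \<le> s"
  shows "measure lborel (busy \<sigma> \<inter> {..<open_time B}) + (s - open_time B)
    \<le> measure lborel (busy \<sigma> \<inter> {..<s})"
proof -
  have "measure lborel (busy \<sigma> \<inter> {..<open_time B}) + measure lborel {open_time B..<s}
      = measure lborel (busy \<sigma> \<inter> {..<open_time B} \<union> {open_time B..<s})"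
  proof -
    have "{open_time B..<s} - busy \<sigma> \<inter> {..<open_time B} = {open_time B..<s}"
      by auto
    then show ?thesis by (simp add: measure_Un2 fmeasurable_Ico)
  qed
  also have "\<dots> \<le> measure lborel (busy \<sigma> \<inter> {..<s})"
    using busy_mono[OF assms(1)] assms(3,4)
    by (intro measure_mono_fmeasurable) (auto simp: busy_feasible_bin[OF assms(2)])
  finally show ?thesis using assms(4) by simp
qed

text \<open>Here \<open>a\<close> is the closing time. All items have arrived by then, so the last
  departure is at most \<open>\<mu> * \<Delta>\<close> later; the load at \<open>a\<close> pays for
  this through the area.\<close>

lemma closed_bin_cost:
  assumes "\<Delta> > 0" "\<mu> \<ge> 0" "K > 1"
    and items: "\<forall>y\<in>set B. 0 < isize y \<and> arrival y \<le> a \<and>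
      \<Delta> \<le> departure y - arrival y \<and> departure y - arrival y \<le> \<mu> * \<Delta>"
    and B: "B \<noteq> []" and full: "1 - 1 / K \<le> load a B"
  shows "release_time B - a \<le> K * (\<mu> / (K - 1)) * area B"
proof -
  obtain y where y: "y \<in> set B" "release_time B = departure y"
    using Max_in[of "departure ` set B"] B unfolding release_time_def by fastforce
  have "release_time B - a \<le> \<mu> * \<Delta>" using y items by force
  \<comment> \<open>The factor \<open>K / (K - 1)\<close> is the reciprocal of the guaranteed load
    \<open>1 - 1 / K\<close>.\<close>
  also have "\<dots> = K * (\<mu> / (K - 1)) * ((1 - 1 / K) * \<Delta>)"
    using \<open>K > 1\<close> by (simp add: field_simps)
  also have "\<dots> \<le> K * (\<mu> / (K - 1)) * area B"
  proof (rule mult_left_mono)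
    have "(1 - 1 / K) * \<Delta> \<le> load a B * \<Delta>"
      using full \<open>\<Delta> > 0\<close> by (intro mult_right_mono) auto
    also have "\<dots> \<le> area B" using items \<open>\<Delta> > 0\<close> by (intro load_le_area) force+
    finally show "(1 - 1 / K) * \<Delta> \<le> area B" .
  qed (use assms in auto)
  finally show ?thesis .
qed

text \<open>
  The current bin is kept out of the area term, and busy time is counted only up to its
  opening; in this form the bound is inductive.
\<close>

lemma cost_next_fit_invariant:
  assumes "\<Delta> > 0" "\<mu> \<ge> 0" "K > 1" and input: "server_input \<Delta> \<mu> \<sigma>"
    and small: "\<forall>x\<in>set \<sigma>. isize x < 1 / K" and "next_fit \<sigma> = B # Bs"
  shows "cost Bs \<le> K * (\<mu> / (K - 1)) * area (concat Bs)
    + measure lborel (busy \<sigma> \<inter> {..<open_time B})"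
  using input small \<open>next_fit \<sigma> = B # Bs\<close>
proof (induction \<sigma> arbitrary: B Bs rule: rev_induct)
  case Nil
  then show ?case by (simp add: next_fit_def)
next
  case (snoc x \<sigma>)
  have input: "server_input \<Delta> \<mu> \<sigma>" and arr: "\<forall>y\<in>set \<sigma>. arrival y \<le> arrival x"
    using snoc.prems(1) by (auto simp: server_input_def sorted_append)
  show ?case
  proof (cases "next_fit \<sigma>")
    case Nil
    then show ?thesis
      using snoc.prems(3) by (simp add: next_fit_snoc cost_def area_def)
  next
    case (Cons C Cs)
    let ?c = "K * (\<mu> / (K - 1))"
    let ?m = "\<lambda>\<tau> t. measure lborel (busy \<tau> \<inter> {..<t})"
    have IH: "cost Cs \<le> ?c * area (concat Cs) + ?m \<sigma> (open_time C)"
      using snoc.IH[OF input _ Cons] snoc.prems(2) by simp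
    have mono: "?m \<sigma> t \<le> ?m (\<sigma> @ [x]) t" for t
      using busy_mono[of \<sigma> "\<sigma> @ [x]"] by (intro measure_mono_fmeasurable) auto
    have pack: "packing \<sigma> (next_fit \<sigma>)"
      using input by (intro packing_next_fit) (auto simp: server_input_def)
    then have C: "feasible_bin C" using Cons by (simp add: packing_def)
    have sub: "set C \<subseteq> set \<sigma>" using set_packing[OF pack] Cons by auto
    have items: "\<forall>y\<in>set C. 0 < isize y \<and> arrival y \<le> arrival x \<and>
        \<Delta> \<le> departure y - arrival y \<and> departure y - arrival y \<le> \<mu> * \<Delta>"
      using input sub arr by (auto simp: server_input_def)
    obtain y where y: "y \<in> set C" using C by (cases C) (auto simp: feasible_bin_def)
    have oa: "open_time C \<le> arrival x" using open_time_le[OF y] y items by force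
    have or: "open_time C \<le> release_time C"
      using items \<open>\<Delta> > 0\<close> by (intro open_time_le_release_time C) force
    show ?thesis
    proof (cases "(\<exists>y\<in>set C. present (arrival x) y) \<and> load (arrival x) C + isize x \<le> 1")
      case True
      then have eq: "B = x # C" "Bs = Cs"
        using snoc.prems(3) Cons by (auto simp: next_fit_snoc)
      \<comment> \<open>The added item arrives no earlier than the opening of \<open>C\<close>, so
        the busy time is cut off at the same point as before.\<close>
      have "open_time B = open_time C"
        using oa y by (cases "set C = {}") (auto simp: open_time_def eq)
      then show ?thesis using IH mono[of "open_time C"] eq by simp
    next
      case False
      then have eq: "B = [x]" "Bs = C # Cs"
        using snoc.prems(3) Cons by (auto simp: next_fit_snoc split: if_splits)
      \<comment> \<open>Replacing \<open>C\<close> as the current bin moves it into the cost and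
        area terms. Its cost must be covered by its area and by the busy time gained as the cutoff
        moves from \<open>open_time C\<close> to \<open>arrival x\<close>.\<close>
      have "release_time C - open_time C + ?m \<sigma> (open_time C) \<le> ?c * area C + ?m \<sigma> (arrival x)"
      proof (cases "release_time C \<le> arrival x")
        case True
        \<comment> \<open>A bin released before the new arrival is paid for by busy time
          alone.\<close>
        have "?m \<sigma> (release_time C) \<le> ?m \<sigma> (arrival x)"
          using True by (intro measure_mono_fmeasurable) auto
        moreover have "0 \<le> ?c * area C"
          using assms items by (intro mult_nonneg_nonneg area_nonneg) force+
        ultimately show ?thesis
          using measure_busy_before_add[OF sub C order_refl or] by linarith
      next
        case r: False
        \<comment> \<open>Since \<open>C\<close> is not yet released, it still holds a present item;
          the new bin was therefore opened because \<open>x\<close> did not fit.\<close>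
        then have "arrival x \<in> busy C" using oa by (simp add: busy_feasible_bin[OF C])
        then have "1 < load (arrival x) C + isize x" using False by (auto simp: mem_busy_iff)
        moreover have "isize x < 1 / K" using snoc.prems(2) by simp
        ultimately have "1 - 1 / K \<le> load (arrival x) C" by linarith
        then have "release_time C - arrival x \<le> ?c * area C"
          using y by (intro closed_bin_cost[OF assms(1-3) items]) auto
        then show ?thesis
          using measure_busy_before_add[OF sub C _ oa] r by linarith
      qed
      moreover have "open_time B = arrival x" by (simp add: eq open_time_def)
      moreover have "cost Bs = (release_time C - open_time C) + cost Cs"
        "area (concat Bs) = area C + area (concat Cs)"
        by (simp_all add: eq cost_def area_append)
      ultimately show ?thesis
        using IH mono[of "arrival x"] by (simp only: distrib_left)
    qed
  qed
qed

text \<open>The invariant omits the last current bin. Its rental period lies in the busy time after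
  its opening, which the invariant has not yet counted.\<close>

lemma cost_next_fit_le:
  assumes "\<Delta> > 0" "\<mu> \<ge> 0" "K > 1" and input: "server_input \<Delta> \<mu> \<sigma>"
    and small: "\<forall>x\<in>set \<sigma>. isize x < 1 / K"
  shows "cost (next_fit \<sigma>) \<le> K * (\<mu> / (K - 1)) * area \<sigma> + measure lborel (busy \<sigma>)"
proof (cases "next_fit \<sigma>")
  case Nil
  then have "\<sigma> = []" by (simp add: next_fit_eq_Nil_iff)
  then show ?thesis by (simp add: next_fit_def cost_def area_def)
next
  case (Cons B Bs)
  let ?c = "K * (\<mu> / (K - 1))"
  have pack: "packing \<sigma> (next_fit \<sigma>)"
    using input by (intro packing_next_fit) (auto simp: server_input_def)
  then have B: "feasible_bin B" using Cons by (simp add: packing_def)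
  have sub: "set B \<subseteq> set \<sigma>" using set_packing[OF pack] Cons by auto
  have items: "\<forall>x\<in>set B. 0 \<le> isize x \<and> arrival x \<le> departure x"
    using input sub \<open>\<Delta> > 0\<close> by (force simp: server_input_def)
  have "area \<sigma> = area (concat (next_fit \<sigma>))"
    using pack by (auto simp: packing_def intro: area_mset)
  then have area: "area \<sigma> = area B + area (concat Bs)"
    by (simp add: Cons area_append)
  have "0 \<le> ?c * area B"
    using assms items by (intro mult_nonneg_nonneg area_nonneg) auto
  moreover have "cost Bs \<le> ?c * area (concat Bs)
      + measure lborel (busy \<sigma> \<inter> {..<open_time B})"
    by (rule cost_next_fit_invariant[OF assms Cons])
  moreover have "measure lborel (busy \<sigma> \<inter> {..<open_time B}) + (release_time B - open_time B)
      \<le> measure lborel (busy \<sigma> \<inter> {..<release_time B})"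
    using open_time_le_release_time[OF B] items
    by (intro measure_busy_before_add[OF sub B]) auto
  moreover have "measure lborel (busy \<sigma> \<inter> {..<release_time B}) \<le> measure lborel (busy \<sigma>)"
    by (intro measure_mono_fmeasurable) auto
  moreover have "cost (next_fit \<sigma>) = (release_time B - open_time B) + cost Bs"
    by (simp add: Cons cost_def)
  ultimately show ?thesis
    unfolding area distrib_left by linarith
qed

section \<open>Combining both families of bins\<close>

text \<open>The witness \<open>Bs\<close> makes the set under \<open>Inf\<close> nonempty, which a
  lower bound on a real infimum requires.\<close>

lemma OPT_ge:
  assumes "packing \<sigma> Bs" "\<And>Cs. packing \<sigma> Cs \<Longrightarrow> c \<le> cost Cs"
  shows "c \<le> OPT \<sigma>"
  unfolding OPT_def using assms by (intro cInf_greatest) auto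

lemma server_input_filter:
  "server_input \<Delta> \<mu> \<sigma> \<Longrightarrow> server_input \<Delta> \<mu> (filter P \<sigma>)"
  by (auto simp: server_input_def sorted_filter)

theorem theorem3:
  fixes \<Delta> \<mu> K :: real
  assumes "\<Delta> > 0" and "\<mu> \<ge> 1" and "K \<ge> 2"
  shows "competitive_ratio_at_most \<Delta> \<mu> (modified_next_fit K) (K * max 1 (\<mu> / (K - 1)) + 1)"
proof -
  \<comment> \<open>The maximum dominates both area coefficients: \<open>K\<close> for large items
    and \<open>K * (\<mu> / (K - 1))\<close> for small ones.\<close>
  define C where "C = K * max 1 (\<mu> / (K - 1))"
  have "K * 1 \<le> C" and C: "K * (\<mu> / (K - 1)) \<le> C"
    unfolding C_def using \<open>K \<ge> 2\<close> by (intro mult_left_mono; simp)+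
  then have C: "K \<le> C" "K * (\<mu> / (K - 1)) \<le> C" "0 \<le> C"
    using \<open>K \<ge> 2\<close> by auto
  \<comment> \<open>The additive constant is \<open>0\<close>, so the bound is even absolute; it is
    written out to serve as the witness for \<open>b\<close>.\<close>
  have "cost (modified_next_fit K \<sigma>) \<le> (C + 1) * OPT \<sigma> + 0" if input: "server_input \<Delta> \<mu> \<sigma>" for \<sigma>
  proof -
    define S where "S = filter (\<lambda>x. isize x < 1 / K) \<sigma>"
    define L where "L = filter (\<lambda>x. 1 / K \<le> isize x) \<sigma>"
    have items: "\<forall>x\<in>set \<sigma>. 0 < isize x \<and> isize x \<le> 1 \<and> arrival x \<le> departure x"
      using input \<open>\<Delta> > 0\<close> by (force simp: server_input_def)
    have S: "server_input \<Delta> \<mu> S" and L: "server_input \<Delta> \<mu> L"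
      using input by (simp_all add: S_def L_def server_input_filter)
    have "cost (next_fit S) \<le> K * (\<mu> / (K - 1)) * area S + measure lborel (busy S)"
      using assms S by (intro cost_next_fit_le) (auto simp: S_def)
    moreover have "K * (\<mu> / (K - 1)) * area S \<le> C * area S"
      using C items by (intro mult_right_mono area_nonneg) (auto simp: S_def less_imp_le)
    moreover have "measure lborel (busy S) \<le> measure lborel (busy \<sigma>)"
      by (intro measure_mono_fmeasurable busy_mono) (auto simp: S_def)
    moreover have "cost (next_fit L) \<le> K * area L"
      using assms L items
      by (intro cost_le_area packing_next_fit) (auto simp: L_def server_input_def)
    moreover have "K * area L \<le> C * area L"
      using C items by (intro mult_right_mono area_nonneg) (auto simp: L_def less_imp_le)
    moreover have "cost (modified_next_fit K \<sigma>) = cost (next_fit S) + cost (next_fit L)"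
      by (simp add: modified_next_fit_def S_def L_def cost_def)
    moreover have "area S + area L = area \<sigma>"
      using area_filter[of "\<lambda>x. isize x < 1 / K" \<sigma>] by (simp add: S_def L_def not_less)
    ultimately have "cost (modified_next_fit K \<sigma>) \<le> C * area \<sigma> + measure lborel (busy \<sigma>)"
      by (smt (verit) distrib_left)
    \<comment> \<open>Area and busy time are each a lower bound on \<open>OPT \<sigma>\<close>; the
      busy time accounts for the summand \<open>1\<close> in the ratio.\<close>
    also have "\<dots> \<le> C * OPT \<sigma> + OPT \<sigma>"
      using C items packing_modified_next_fit[OF input]
      by (intro add_mono mult_left_mono OPT_ge area_le_cost measure_busy_le_cost) auto
    finally show ?thesis by (simp add: algebra_simps)
  qed
  then show ?thesis unfolding competitive_ratio_at_most_def C_def by blast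
qed

end
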